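(* Consider the continuous-time plant $\dot x=A_px+B_pu$, $y=C_px$ with $x(t)\in\mathbb{R}^n$, $u(t)\in\mathbb{R}^m$, $y(t)\in\mathbb{R}^p$, in feedback with the bias-free static implicit controller $$\eta=\phi(W\eta+Uy),\qquad u=Ky+V\eta,\qquad \eta(t)\in\mathbb{R}^q.$$ Suppose that $\phi$ is componentwise nonexpansive, that $\phi$ satisfies the static sector condition with diagonal matrices $D_0,D_1$, and that $\lambda_{\mathrm{pf}}(|W|)<1$. If there exist $P\succ0$ in $\mathbb{R}^{n\times n}$, a diagonal $\Lambda\succeq0$ in $\mathbb{R}^{q\times q}$, and $\alpha>0$ such that $$\mathrm{He}(X^\top PF_c)+\alpha X^\top PX+M_\Lambda\preceq0,$$ then the origin of the closed loop is globally exponentially stable and every closed-loop trajectory satisfies, for all $t\ge0$, $$x(t)^\top Px(t)\le e^{-\alpha t}x(0)^\top Px(0).$$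
   Context: Componentwise nonexpansive: $\phi:\mathbb{R}^q\to\mathbb{R}^q$ acts componentwise, $\phi(r)_i=\phi_i(r_i)$, and $|\phi(r)-\phi(s)|\le|r-s|$ for all $r,s$, with componentwise absolute values and inequalities. Static sector condition: $\phi(0)=0$ and there are diagonal matrices $D_0=\mathrm{diag}(\underline m_i)$, $D_1=\mathrm{diag}(\overline m_i)$ with $0\le\underline m_i\le\overline m_i\le1$ such that $(\phi_i(z_i)-\underline m_iz_i)(\overline m_iz_i-\phi_i(z_i))\ge0$ for all $z_i\in\mathbb{R}$, $i=1,\dots,q$. Notation: $X=[I_n\;\;0]\in\mathbb{R}^{n\times(n+q)}$, $H=[0\;\;I_q]\in\mathbb{R}^{q\times(n+q)}$, $Z=[UC_p\;\;W]$, $F_c=[A_p+B_pKC_p\;\;B_pV]$, and $$M_\Lambda=-2Z^\top D_0\Lambda D_1Z+\mathrm{He}\big(H^\top\Lambda(D_0+D_1)Z\big)-2H^\top\Lambda H,$$ where $\mathrm{He}(Y)=Y+Y^\top$. $P\succ0$ means symmetric positive definite; $\preceq,\succeq$ denote the semidefinite order. $|W|$ is the componentwise absolute value and $\lambda_{\mathrm{pf}}(|W|)$ is the Perron--Frobenius eigenvalue (spectral radius) of the nonnegative matrix $|W|$. All matrices are real of compatible dimensions. At each time, $\eta$ is the (unique) solution of the algebraic fixed-point equation for the current $y$. *)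

theory Defs
  imports "HOL-Analysis.Analysis"
begin

text \<open>
  Block matrices are indexed by sum types, so that \<open>\<real>\<^sup>n\<^sup>+\<^sup>q\<close> is \<open>real ^ ('n + 'q)\<close>.
  On \<open>real ^ 'n\<close> and \<open>real ^ 'n ^ 'm\<close> the library's \<open>\<le>\<close> and \<open>\<bar>_\<bar>\<close> are componentwise;
  the semidefinite order is \<open>loewner_le\<close>.
\<close>

definition block_row :: "'a ^ 'n ^ 'm \<Rightarrow> 'a ^ 'q ^ 'm \<Rightarrow> 'a ^ ('n + 'q) ^ 'm" where
  "block_row A B = (\<chi> i j. case j of Inl k \<Rightarrow> A $ i $ k | Inr l \<Rightarrow> B $ i $ l)"

definition diag_of :: "real ^ 'n \<Rightarrow> real ^ 'n ^ 'n" where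
  "diag_of d = (\<chi> i j. if i = j then d $ i else 0)"

definition is_diagonal :: "real ^ 'n ^ 'n \<Rightarrow> bool" where
  "is_diagonal A \<longleftrightarrow> (\<forall>i j. i \<noteq> j \<longrightarrow> A $ i $ j = 0)"

definition herm :: "real ^ 'n ^ 'n \<Rightarrow> real ^ 'n ^ 'n" where
  "herm Y = Y + transpose Y"

definition pos_def :: "real ^ 'n ^ 'n \<Rightarrow> bool" where
  "pos_def A \<longleftrightarrow> transpose A = A \<and> (\<forall>v. v \<noteq> 0 \<longrightarrow> 0 < v \<bullet> (A *v v))"

definition pos_semidef :: "real ^ 'n ^ 'n \<Rightarrow> bool" where
  "pos_semidef A \<longleftrightarrow> transpose A = A \<and> (\<forall>v. 0 \<le> v \<bullet> (A *v v))"

definition loewner_le :: "real ^ 'n ^ 'n \<Rightarrow> real ^ 'n ^ 'n \<Rightarrow> bool" where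
  "loewner_le A B \<longleftrightarrow> pos_semidef (B - A)"

text \<open>
  The Perron--Frobenius eigenvalue of a nonnegative matrix, as its spectral radius: the
  eigenvalues range over the complex numbers.
\<close>

definition complex_eigenvalues :: "real ^ 'n ^ 'n \<Rightarrow> complex set" where
  "complex_eigenvalues A =
     {z. \<exists>v :: complex ^ 'n. v \<noteq> 0 \<and> (\<chi> i j. complex_of_real (A $ i $ j)) *v v = z *s v}"

definition lambda_pf :: "real ^ 'n ^ 'n \<Rightarrow> real" where
  "lambda_pf A = (SUP z \<in> complex_eigenvalues A. cmod z)"

definition acts_componentwise :: "(real ^ 'q \<Rightarrow> real ^ 'q) \<Rightarrow> ('q \<Rightarrow> real \<Rightarrow> real) \<Rightarrow> bool" where
  "acts_componentwise \<phi> \<phi>c \<longleftrightarrow> (\<forall>r i. \<phi> r $ i = \<phi>c i (r $ i))"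

definition componentwise_nonexpansive ::
    "(real ^ 'q \<Rightarrow> real ^ 'q) \<Rightarrow> ('q \<Rightarrow> real \<Rightarrow> real) \<Rightarrow> bool" where
  "componentwise_nonexpansive \<phi> \<phi>c \<longleftrightarrow>
     acts_componentwise \<phi> \<phi>c \<and> (\<forall>r s. \<bar>\<phi> r - \<phi> s\<bar> \<le> \<bar>r - s\<bar>)"

definition static_sector ::
    "(real ^ 'q \<Rightarrow> real ^ 'q) \<Rightarrow> ('q \<Rightarrow> real \<Rightarrow> real) \<Rightarrow> real ^ 'q ^ 'q \<Rightarrow> real ^ 'q ^ 'q \<Rightarrow> bool" where
  "static_sector \<phi> \<phi>c D0 D1 \<longleftrightarrow>
     acts_componentwise \<phi> \<phi>c \<and> \<phi> 0 = 0 \<and>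
     (\<exists>l u. D0 = diag_of l \<and> D1 = diag_of u \<and>
        (\<forall>i. 0 \<le> l $ i \<and> l $ i \<le> u $ i \<and> u $ i \<le> 1) \<and>
        (\<forall>i z. (\<phi>c i z - l $ i * z) * (u $ i * z - \<phi>c i z) \<ge> 0))"

definition mat_X :: "real ^ ('n + 'q::finite) ^ 'n" where
  "mat_X = block_row (mat 1) 0"

definition mat_H :: "real ^ ('n::finite + 'q) ^ 'q" where
  "mat_H = block_row 0 (mat 1)"

definition mat_Z ::
    "real ^ 'p ^ 'q \<Rightarrow> real ^ 'n ^ 'p \<Rightarrow> real ^ 'q ^ 'q \<Rightarrow> real ^ ('n + 'q) ^ 'q" where
  "mat_Z U Cp W = block_row (U ** Cp) W"

definition mat_Fc ::
    "real ^ 'n ^ 'n \<Rightarrow> real ^ 'm ^ 'n \<Rightarrow> real ^ 'n ^ 'p \<Rightarrow> real ^ 'p ^ 'm \<Rightarrow> real ^ 'q ^ 'm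
       \<Rightarrow> real ^ ('n + 'q) ^ 'n" where
  "mat_Fc Ap Bp Cp K V = block_row (Ap + Bp ** K ** Cp) (Bp ** V)"

definition mat_M ::
    "real ^ 'q ^ 'q \<Rightarrow> real ^ 'q ^ 'q \<Rightarrow> real ^ 'q ^ 'q \<Rightarrow> real ^ ('n::finite + 'q) ^ 'q
       \<Rightarrow> real ^ ('n + 'q) ^ ('n + 'q)" where
  "mat_M D0 D1 \<Lambda> Z =
     - (2 *\<^sub>R (transpose Z ** D0 ** \<Lambda> ** D1 ** Z))
     + herm (transpose mat_H ** \<Lambda> ** (D0 + D1) ** Z)
     - 2 *\<^sub>R (transpose mat_H ** \<Lambda> ** (mat_H :: real ^ ('n + 'q) ^ 'q))"

definition closed_loop_trajectory ::
    "real ^ 'n ^ 'n \<Rightarrow> real ^ 'm ^ 'n \<Rightarrow> real ^ 'n ^ 'p \<Rightarrow>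
     real ^ 'p ^ 'm \<Rightarrow> real ^ 'q ^ 'm \<Rightarrow> real ^ 'q ^ 'q \<Rightarrow> real ^ 'p ^ 'q \<Rightarrow>
     (real ^ 'q \<Rightarrow> real ^ 'q) \<Rightarrow>
     (real \<Rightarrow> real ^ 'n) \<Rightarrow> (real \<Rightarrow> real ^ 'm) \<Rightarrow> (real \<Rightarrow> real ^ 'p) \<Rightarrow> (real \<Rightarrow> real ^ 'q) \<Rightarrow> bool" where
  "closed_loop_trajectory Ap Bp Cp K V W U \<phi> x u y \<eta> \<longleftrightarrow>
     (\<forall>t\<ge>0. (x has_vector_derivative (Ap *v x t + Bp *v u t)) (at t within {0..}) \<and>
            y t = Cp *v x t \<and>
            \<eta> t = \<phi> (W *v \<eta> t + U *v y t) \<and>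
            u t = K *v y t + V *v \<eta> t)"

definition closed_loop_states ::
    "real ^ 'n ^ 'n \<Rightarrow> real ^ 'm ^ 'n \<Rightarrow> real ^ 'n ^ 'p \<Rightarrow>
     real ^ 'p ^ 'm \<Rightarrow> real ^ 'q ^ 'm \<Rightarrow> real ^ 'q ^ 'q \<Rightarrow> real ^ 'p ^ 'q \<Rightarrow>
     (real ^ 'q \<Rightarrow> real ^ 'q) \<Rightarrow> (real \<Rightarrow> real ^ 'n) set" where
  "closed_loop_states Ap Bp Cp K V W U \<phi> =
     {x. \<exists>u y \<eta>. closed_loop_trajectory Ap Bp Cp K V W U \<phi> x u y \<eta>}"

text \<open>
  Global exponential stability of the origin for a system given by its set of state
  trajectories on \<open>[0, \<infinity>)\<close>.  The first conjunct requires a global trajectory from every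
  initial state, so the decay estimate cannot hold vacuously; the origin is then an
  equilibrium by the estimate with \<open>x 0 = 0\<close>.
\<close>

definition origin_globally_exponentially_stable ::
    "(real \<Rightarrow> 'a :: real_normed_vector) set \<Rightarrow> bool" where
  "origin_globally_exponentially_stable T \<longleftrightarrow>
     (\<forall>x0. \<exists>x\<in>T. x 0 = x0) \<and>
     (\<exists>c>0. \<exists>\<mu>>0. \<forall>x\<in>T. \<forall>t\<ge>0. norm (x t) \<le> c * exp (- \<mu> * t) * norm (x 0))"

end

theory Submission
  imports Defs
begin

text \<open>
  Evaluated at \<open>(x, \<eta>)\<close>, the matrix inequality says that the derivative of \<open>x\<^sup>T P x\<close> plus
  \<open>\<alpha> x\<^sup>T P x\<close> is at most minus twice the \<open>\<Lambda>\<close>-weighted sum of the sector products, which are nonnegative;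
  this gives the decay of \<open>x\<^sup>T P x\<close>.  For the existence of trajectories, \<open>\<lambda>\<^sub>p\<^sub>f(|W|) < 1\<close> yields
  a vector \<open>w > 0\<close> with \<open>|W| w < w\<close>.  In the maximum norm weighted by \<open>w\<close> the map
  \<open>\<eta> \<mapsto> \<phi> (W \<eta> + b)\<close> is a contraction, so its fixed point is a globally Lipschitz function of
  \<open>b\<close>, and the closed loop is a globally Lipschitz differential equation.
\<close>

section \<open>Perron--Frobenius: a strict positive supersolution\<close>

lemma finite_type_argmax:
  fixes f :: "'a::finite \<Rightarrow> real"
  obtains i where "\<And>j. f j \<le> f i"
proof -
  have "Max (range f) \<in> range f"
    by (rule Max_in) auto
  then obtain i where "f i = Max (range f)"
    by (metis rangeE)
  then show ?thesis
    by (metis Max_ge finite finite_imageI rangeI that)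
qed

text \<open>At a component of largest modulus of an eigenvector, the eigenvalue equation bounds
  \<open>cmod z\<close> by an absolute row sum. Boundedness is what makes the real supremum in
  \<open>lambda_pf\<close> an upper bound at all.\<close>

lemma bdd_above_complex_eigenvalues:
  fixes A :: "real ^ 'q ^ 'q"
  shows "bdd_above (cmod ` complex_eigenvalues A)"
proof (rule bdd_aboveI2)
  fix z assume "z \<in> complex_eigenvalues A"
  then obtain v where v: "v \<noteq> 0" "(\<chi> i j. complex_of_real (A $ i $ j)) *v v = z *s v"
    unfolding complex_eigenvalues_def by auto
  obtain i where i: "\<And>j. cmod (v $ j) \<le> cmod (v $ i)"
    using finite_type_argmax[of "\<lambda>j. cmod (v $ j)"] by blast
  have pos: "cmod (v $ i) > 0"
  proof (rule ccontr)
    assume "\<not> cmod (v $ i) > 0"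
    then have "v $ j = 0" for j
      using i[of j] by simp
    then show False
      using v(1) by (simp add: vec_eq_iff)
  qed
  have "cmod z * cmod (v $ i) = cmod (((\<chi> i j. complex_of_real (A $ i $ j)) *v v) $ i)"
    by (simp add: v norm_mult)
  also have "\<dots> \<le> (\<Sum>j\<in>UNIV. \<bar>A $ i $ j\<bar> * cmod (v $ j))"
    unfolding matrix_vector_mult_def by (auto intro!: sum_norm_le simp: norm_mult)
  also have "\<dots> \<le> (\<Sum>j\<in>UNIV. \<bar>A $ i $ j\<bar> * cmod (v $ i))"
    by (intro sum_mono mult_left_mono i) auto
  also have "\<dots> = (\<Sum>j\<in>UNIV. \<bar>A $ i $ j\<bar>) * cmod (v $ i)"
    by (simp add: sum_distrib_right)
  finally have "cmod z \<le> (\<Sum>j\<in>UNIV. \<bar>A $ i $ j\<bar>)"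
    using pos by simp
  \<comment> \<open>The row \<open>i\<close> depends on the eigenvector; summing over all rows gives
    one bound for all eigenvalues.\<close>
  also have "\<dots> \<le> (\<Sum>i\<in>UNIV. \<Sum>j\<in>UNIV. \<bar>A $ i $ j\<bar>)"
    by (rule member_le_sum) (auto intro: sum_nonneg)
  finally show "cmod z \<le> (\<Sum>i\<in>UNIV. \<Sum>j\<in>UNIV. \<bar>A $ i $ j\<bar>)" .
qed

text \<open>A real eigenvector, read as a complex one, puts \<open>c\<close> into the set whose
  moduli define \<open>lambda_pf\<close>.\<close>

lemma real_eigenvalue_le_lambda_pf:
  fixes A :: "real ^ 'q ^ 'q"
  assumes "v \<noteq> 0" and "A *v v = c *\<^sub>R v"
  shows "c \<le> lambda_pf A"
proof -
  let ?v = "\<chi> i. complex_of_real (v $ i)"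
  have "?v \<noteq> 0"
    using assms(1) by (auto simp: vec_eq_iff)
  moreover have "(\<chi> i j. complex_of_real (A $ i $ j)) *v ?v = complex_of_real c *s ?v"
    using assms(2) by (auto simp: vec_eq_iff matrix_vector_mult_def simp flip: of_real_mult of_real_sum)
  ultimately have "complex_of_real c \<in> complex_eigenvalues A"
    unfolding complex_eigenvalues_def by blast
  then have "cmod (complex_of_real c) \<le> lambda_pf A"
    unfolding lambda_pf_def by (intro cSUP_upper bdd_above_complex_eigenvalues)
  then show ?thesis
    by simp
qed

text \<open>A kernel vector would be an eigenvector of \<open>A\<close> for \<open>1 / t\<close>,
  which is at least 1. Hence Cramer's rule is available along the whole segment from
  \<open>mat 1\<close> to \<open>mat 1 - A\<close>.\<close>

lemma det_mat1_minus_scaleR_nz: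
  fixes A :: "real ^ 'q ^ 'q"
  assumes "lambda_pf A < 1" and "0 \<le> t" "t \<le> 1"
  shows "det (mat 1 - t *\<^sub>R A) \<noteq> 0"
proof
  assume "det (mat 1 - t *\<^sub>R A) = 0"
  then obtain v where "v \<noteq> 0" and "(mat 1 - t *\<^sub>R A) *v v = 0"
    by (metis invertible_det_nz invertible_left_inverse matrix_left_invertible_ker)
  then have v: "v = t *\<^sub>R (A *v v)"
    by (simp add: matrix_vector_mult_diff_rdistrib scaleR_matrix_vector_assoc)
  have "t \<noteq> 0"
    using v \<open>v \<noteq> 0\<close> by auto
  then have "A *v v = (1 / t) *\<^sub>R v"
    by (subst (2) v) simp
  then have "1 / t \<le> lambda_pf A"
    by (rule real_eigenvalue_le_lambda_pf[OF \<open>v \<noteq> 0\<close>])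
  moreover have "1 \<le> 1 / t"
    using assms \<open>t \<noteq> 0\<close> by (simp add: field_simps)
  ultimately show False
    using assms by simp
qed

text \<open>
  The solution \<open>v t\<close> of \<open>v = 1 + t A v\<close> is continuous on \<open>[0, 1]\<close> by Cramer's rule, and
  \<open>v t \<ge> 0\<close> forces \<open>v t \<ge> 1\<close>; so the set of \<open>t\<close> with \<open>v t \<ge> 0\<close> is open and closed in \<open>[0, 1]\<close>.
\<close>

lemma exists_pos_strict_supersolution:
  fixes A :: "real ^ 'q ^ 'q"
  assumes nonneg: "\<And>i j. 0 \<le> A $ i $ j" and pf: "lambda_pf A < 1"
  obtains w where "\<And>i. 0 < w $ i" and "\<And>i. (A *v w) $ i < w $ i"
proof -
  define M where "M t = mat 1 - t *\<^sub>R A" for t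
  \<comment> \<open>Cramer's quotients for \<open>M t *v v t = 1\<close>, with \<open>1\<close> the
    all-ones vector; in this explicit form continuity in \<open>t\<close> is visible.\<close>
  define v :: "real \<Rightarrow> real ^ 'q" where
    "v t = (\<chi> k. det (\<chi> i j. if j = k then (1 :: real ^ 'q) $ i else M t $ i $ j) / det (M t))" for t
  have nz: "det (M t) \<noteq> 0" if "t \<in> {0..1}" for t
    unfolding M_def using det_mat1_minus_scaleR_nz[OF pf] that by auto
  have sol: "v t $ i = 1 + t * (A *v v t) $ i" if "t \<in> {0..1}" for t i
  proof -
    have "M t *v v t = 1"
      using cramer[OF nz[OF that]] unfolding v_def by blast
    then have "v t - t *\<^sub>R (A *v v t) = 1"
      by (simp add: M_def matrix_vector_mult_diff_rdistrib scaleR_matrix_vector_assoc)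
    then show ?thesis
      by (metis add.commute diff_add_cancel one_index real_scaleR_def vector_add_component
          vector_scaleR_component)
  qed
  have ge1: "1 \<le> v t $ i" if "t \<in> {0..1}" "\<And>i. 0 \<le> v t $ i" for t i
  proof -
    have "0 \<le> (A *v v t) $ i"
      unfolding matrix_vector_mult_def using that nonneg by (auto intro!: sum_nonneg)
    then show ?thesis
      using sol[OF that(1), of i] that(1) by simp
  qed
  have cont: "continuous_on {0..1} (\<lambda>t. v t $ i)" for i
  proof -
    have M: "continuous_on S (\<lambda>t. M t $ i $ j)" for i j S
      unfolding M_def by (auto intro!: continuous_intros)
    have "continuous_on {0..1}
        (\<lambda>t. det (\<chi> k j. if j = i then (1 :: real ^ 'q) $ k else M t $ k $ j) / det (M t))"
    proof (intro continuous_on_divide ballI nz)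
      show "continuous_on {0..1} (\<lambda>t. det (M t))"
        unfolding det_def by (intro continuous_intros M)
      show "continuous_on {0..1}
          (\<lambda>t. det (\<chi> k j. if j = i then (1 :: real ^ 'q) $ k else M t $ k $ j))"
        unfolding det_def
      proof (intro continuous_on_sum continuous_on_mult continuous_on_prod continuous_on_const)
        fix p k
        show "continuous_on {0..1}
            (\<lambda>t. (\<chi> k j. if j = i then (1 :: real ^ 'q) $ k else M t $ k $ j) $ k $ p k)"
          by (cases "p k = i") (simp_all add: M)
      qed
    qed
    then show ?thesis
      by (simp add: v_def)
  qed
  define T where "T = (\<Inter>i. {0..1} \<inter> (\<lambda>t. v t $ i) -` {0..})"
  \<comment> \<open>By \<open>ge1\<close> no component lies between 0 and 1 once all are
    nonnegative, so any threshold in between, here 1/2, describes the same set. The first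
    description shows that \<open>T\<close> is closed, this one that it is open.\<close>
  have T_alt: "T = (\<Inter>i. {0..1} \<inter> (\<lambda>t. v t $ i) -` {1/2<..})"
  proof (intro equalityI subsetI)
    fix t assume "t \<in> T"
    then have *: "t \<in> {0..1}" "\<And>i. 0 \<le> v t $ i"
      by (auto simp: T_def)
    then show "t \<in> (\<Inter>i. {0..1} \<inter> (\<lambda>t. v t $ i) -` {1/2<..})"
      using less_le_trans[OF _ ge1[OF *], of "1/2"] by auto
  next
    fix t assume "t \<in> (\<Inter>i. {0..1} \<inter> (\<lambda>t. v t $ i) -` {1/2<..})"
    then show "t \<in> T"
      unfolding T_def by (auto intro!: less_imp_le[OF less_trans[of 0 "1/2"]])
  qed
  have "closedin (top_of_set {0..1}) T"
    unfolding T_def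
    by (intro closedin_INT continuous_closedin_preimage cont) auto
  moreover have "openin (top_of_set {0..1}) T"
    unfolding T_alt
    by (intro openin_INT2 continuous_openin_preimage_gen cont) auto
  moreover have "0 \<in> T"
    using sol[of 0] by (auto simp: T_def)
  ultimately have "T = {0..1}"
    using connected_clopen[of "{0..1::real}"] by auto
  then have "1 \<in> T"
    by simp
  then have v1: "1 \<le> v 1 $ i" for i
    by (intro ge1) (auto simp: T_def)
  show ?thesis
  proof (rule that[of "v 1"])
    show "0 < v 1 $ i" for i
      using v1[of i] by simp
    \<comment> \<open>At \<open>t = 1\<close> the equation reads \<open>v = 1 + A v\<close>, so the
      gap is exactly 1 in every component.\<close>
    show "(A *v v 1) $ i < v 1 $ i" for i
      using sol[of 1 i] by simp
  qed
qed

section \<open>The implicit equation\<close>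

lemma abs_matrix_vector_mult_le:
  fixes A :: "real ^ 'n ^ 'm"
  assumes "\<And>j. \<bar>d $ j\<bar> \<le> c * w $ j"
  shows "\<bar>(A *v d) $ i\<bar> \<le> c * (\<bar>A\<bar> *v w) $ i"
proof -
  have "\<bar>(A *v d) $ i\<bar> \<le> (\<Sum>j\<in>UNIV. \<bar>A $ i $ j\<bar> * \<bar>d $ j\<bar>)"
    unfolding matrix_vector_mult_def by (simp add: sum_abs flip: abs_mult)
  also have "\<dots> \<le> (\<Sum>j\<in>UNIV. \<bar>A $ i $ j\<bar> * (c * w $ j))"
    by (intro sum_mono mult_left_mono assms) auto
  also have "\<dots> = c * (\<bar>A\<bar> *v w) $ i"
    by (simp add: matrix_vector_mult_def abs_vec_def sum_distrib_left mult_ac)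
  finally show ?thesis .
qed

text \<open>Take a component where \<open>\<bar>d $ j\<bar> / w $ j\<close> is largest. There the
  \<open>W\<close> term contributes at most \<open>g\<close> times this maximum and is absorbed into
  the left side, which leaves the factor \<open>1 - g\<close>.\<close>

lemma weighted_contraction_bound:
  fixes W :: "real ^ 'q::finite ^ 'q"
  assumes w: "\<And>i. 0 < w $ i" and g: "\<And>i. (\<bar>W\<bar> *v w) $ i \<le> g * w $ i" and "g < 1"
    and d: "\<And>i. \<bar>d $ i\<bar> \<le> \<bar>(W *v d) $ i\<bar> + b * w $ i"
  shows "\<bar>d $ i\<bar> \<le> b / (1 - g) * w $ i"
proof -
  obtain k where k: "\<And>j. \<bar>d $ j\<bar> / w $ j \<le> \<bar>d $ k\<bar> / w $ k"
    using finite_type_argmax[of "\<lambda>j. \<bar>d $ j\<bar> / w $ j"] by blast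
  define c where "c = \<bar>d $ k\<bar> / w $ k"
  have dc: "\<bar>d $ j\<bar> \<le> c * w $ j" for j
    using k[of j] w[of j] by (simp add: c_def pos_divide_le_eq)
  have "0 \<le> c"
    using w[of k] by (simp add: c_def)
  have "c * w $ k = \<bar>d $ k\<bar>"
    using w[of k] by (simp add: c_def)
  also have "\<dots> \<le> c * (\<bar>W\<bar> *v w) $ k + b * w $ k"
    using d[of k] abs_matrix_vector_mult_le[of d c w W k] dc by simp
  also have "\<dots> \<le> c * (g * w $ k) + b * w $ k"
    using mult_left_mono[OF g \<open>0 \<le> c\<close>] by simp
  also have "\<dots> = (c * g + b) * w $ k"
    by (simp add: algebra_simps)
  finally have "c \<le> c * g + b"
    using w[of k] by simp
  then have "c \<le> b / (1 - g)"
    using \<open>g < 1\<close> by (simp add: pos_le_divide_eq algebra_simps)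
  then show ?thesis
    using dc[of i] mult_right_mono[OF _ less_imp_le[OF w[of i]]] order_trans by blast
qed

text \<open>Existence comes from Brouwer's theorem on a box with sides proportional to
  \<open>w\<close>, so the weighted norm need not be set up as a metric. The contraction factor
  serves to keep the box invariant and to compare solutions for different \<open>b\<close>.\<close>

lemma implicit_equation_solution:
  fixes W :: "real ^ 'q ^ 'q" and \<phi> :: "real ^ 'q \<Rightarrow> real ^ 'q"
  assumes pf: "lambda_pf \<bar>W\<bar> < 1" and nonexp: "\<And>r s. \<bar>\<phi> r - \<phi> s\<bar> \<le> \<bar>r - s\<bar>"
  obtains G L where "\<And>b. G b = \<phi> (W *v G b + b)" and "L-lipschitz_on UNIV G"
proof -
  have ne: "\<bar>\<phi> r $ i - \<phi> s $ i\<bar> \<le> \<bar>r $ i - s $ i\<bar>" for r s i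
    using nonexp[of r s] by (simp add: less_eq_vec_def abs_vec_def)
  have "0 \<le> \<bar>W\<bar> $ i $ j" for i j
    by (simp add: abs_vec_def)
  then obtain w where w: "\<And>i. 0 < w $ i" and lt: "\<And>i. (\<bar>W\<bar> *v w) $ i < w $ i"
    using exists_pos_strict_supersolution[OF _ pf] by metis
  obtain k where k: "\<And>j. (\<bar>W\<bar> *v w) $ j / w $ j \<le> (\<bar>W\<bar> *v w) $ k / w $ k"
    using finite_type_argmax[of "\<lambda>j. (\<bar>W\<bar> *v w) $ j / w $ j"] by blast
  \<comment> \<open>The largest of finitely many ratios turns the strict inequalities
    \<open>lt\<close> into one uniform factor below 1.\<close>
  define g where "g = (\<bar>W\<bar> *v w) $ k / w $ k"
  have "g < 1"
    using lt[of k] w[of k] by (simp add: g_def)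
  have g: "(\<bar>W\<bar> *v w) $ j \<le> g * w $ j" for j
    using k[of j] w[of j] by (simp add: g_def pos_divide_le_eq)
  \<comment> \<open>Chosen so that \<open>1 \<le> B * w $ i\<close> for every \<open>i\<close>,
    which converts Euclidean norms into weighted componentwise bounds.\<close>
  define B where "B = (\<Sum>i\<in>UNIV. 1 / w $ i)"
  have "0 \<le> B"
    unfolding B_def using w by (intro sum_nonneg) (simp add: less_imp_le)
  have B: "\<bar>b $ i\<bar> \<le> norm b * B * w $ i" for b i
  proof -
    have "1 / w $ i \<le> B"
      unfolding B_def by (rule member_le_sum) (auto simp: less_imp_le[OF w])
    then have "1 \<le> B * w $ i"
      using w[of i] by (simp add: pos_divide_le_eq)
    then have "norm b * 1 \<le> norm b * (B * w $ i)"
      by (intro mult_left_mono) auto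
    then show ?thesis
      using component_le_norm_cart[of b i] by (simp add: mult.assoc)
  qed
  have ex: "\<exists>\<eta>. \<eta> = \<phi> (W *v \<eta> + b)" for b
  proof -
    define f where "f \<eta> = \<phi> (W *v \<eta> + b)" for \<eta>
    \<comment> \<open>The radius solves \<open>norm (\<phi> b) * B + g * R = R\<close>, exactly what
      invariance of the box requires.\<close>
    define R where "R = norm (\<phi> b) * B / (1 - g)"
    have "0 \<le> R"
      unfolding R_def using \<open>0 \<le> B\<close> \<open>g < 1\<close> by simp
    let ?S = "cbox (- (R *\<^sub>R w)) (R *\<^sub>R w)"
    have S: "\<eta> \<in> ?S \<longleftrightarrow> (\<forall>i. \<bar>\<eta> $ i\<bar> \<le> R * w $ i)" for \<eta>
      by (auto simp: mem_box_cart abs_le_iff minus_le_iff)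
    have "1-lipschitz_on UNIV \<phi>"
      using ne by (intro lipschitz_onI) (auto simp: dist_norm intro!: norm_le_componentwise_cart)
    then have "continuous_on UNIV \<phi>"
      by (rule lipschitz_on_continuous_on)
    then have "continuous_on ?S f"
      unfolding f_def
      by (rule continuous_on_compose2)
         (intro continuous_on_add continuous_on_const linear_continuous_on
            matrix_vector_mul_bounded_linear, simp)
    moreover have "f \<eta> \<in> ?S" if "\<eta> \<in> ?S" for \<eta>
      unfolding S
    proof
      fix i
      \<comment> \<open>Nonexpansiveness is applied against the value
        \<open>f 0 = \<phi> b\<close>.\<close>
      have "\<bar>f \<eta> $ i\<bar> \<le> \<bar>\<phi> b $ i\<bar> + \<bar>(W *v \<eta>) $ i\<bar>"
        using ne[of "W *v \<eta> + b" i b] by (simp add: f_def)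
      also have "\<dots> \<le> norm (\<phi> b) * B * w $ i + R * (\<bar>W\<bar> *v w) $ i"
        using that by (intro add_mono B abs_matrix_vector_mult_le) (auto simp: S)
      also have "\<dots> \<le> norm (\<phi> b) * B * w $ i + R * (g * w $ i)"
        using mult_left_mono[OF g \<open>0 \<le> R\<close>] by simp
      also have "norm (\<phi> b) * B = R * (1 - g)"
        using \<open>g < 1\<close> by (simp add: R_def)
      finally show "\<bar>f \<eta> $ i\<bar> \<le> R * w $ i"
        by (simp add: algebra_simps)
    qed
    moreover have "0 \<in> ?S"
      unfolding S using \<open>0 \<le> R\<close> w by (simp add: less_imp_le)
    ultimately obtain \<eta> where "f \<eta> = \<eta>"
      using brouwer[OF compact_cbox convex_box(1), of "- (R *\<^sub>R w)" "R *\<^sub>R w" f] by blast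
    then show ?thesis
      unfolding f_def by metis
  qed
  \<comment> \<open>The sum of the weights comes from adding up the componentwise bounds: the
    Euclidean norm is at most the sum of the absolute components.\<close>
  define L where "L = B / (1 - g) * (\<Sum>i\<in>UNIV. w $ i)"
  have lip: "norm (\<eta> - \<eta>') \<le> L * norm (b - b')"
    if \<eta>: "\<eta> = \<phi> (W *v \<eta> + b)" "\<eta>' = \<phi> (W *v \<eta>' + b')" for \<eta> \<eta>' b b'
  proof -
    have "\<bar>(\<eta> - \<eta>') $ i\<bar> \<le> \<bar>(W *v (\<eta> - \<eta>')) $ i\<bar> + norm (b - b') * B * w $ i" for i
    proof -
      have "\<bar>(\<eta> - \<eta>') $ i\<bar> \<le> \<bar>(W *v \<eta> + b) $ i - (W *v \<eta>' + b') $ i\<bar>"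
        by (subst \<eta>(1), subst \<eta>(2), simp only: vector_minus_component ne)
      also have "\<dots> \<le> \<bar>(W *v (\<eta> - \<eta>')) $ i\<bar> + \<bar>(b - b') $ i\<bar>"
        by (simp add: matrix_vector_mult_diff_distrib)
      finally show ?thesis
        using B[of "b - b'" i] by linarith
    qed
    then have "\<bar>(\<eta> - \<eta>') $ i\<bar> \<le> norm (b - b') * B / (1 - g) * w $ i" for i
      by (rule weighted_contraction_bound[OF w g \<open>g < 1\<close>])
    then have "(\<Sum>i\<in>UNIV. \<bar>(\<eta> - \<eta>') $ i\<bar>) \<le> (\<Sum>i\<in>UNIV. norm (b - b') * B / (1 - g) * w $ i)"
      by (rule sum_mono)
    also have "\<dots> = L * norm (b - b')"
      by (simp add: L_def mult_ac sum_distrib_left sum_divide_distrib)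
    finally show ?thesis
      using norm_le_l1_cart order_trans by blast
  qed
  obtain G where G: "\<And>b. G b = \<phi> (W *v G b + b)"
    using ex by metis
  have "0 \<le> L"
    unfolding L_def using \<open>0 \<le> B\<close> \<open>g < 1\<close> w by (simp add: sum_nonneg less_imp_le)
  then have "L-lipschitz_on UNIV G"
    using lip[OF G G] by (intro lipschitz_onI) (auto simp: dist_norm)
  with G show ?thesis
    by (rule that)
qed

section \<open>Global solutions of Lipschitz differential equations\<close>

lemma has_vector_derivative_integral_from_0:
  fixes g :: "real \<Rightarrow> 'a::banach"
  assumes "continuous_on {0..} g" and "0 \<le> t"
  shows "((\<lambda>u. integral {0..u} g) has_vector_derivative g t) (at t within {0..})"
proof -
  \<comment> \<open>Ending the interval at \<open>t + 1\<close> keeps \<open>t\<close> away from the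
    right end, so that near \<open>t\<close> it coincides with the half-line.\<close>
  have "((\<lambda>u. integral {0..u} g) has_vector_derivative g t) (at t within {0..t + 1})"
    using assms by (intro integral_has_vector_derivative continuous_on_subset[OF assms(1)]) auto
  moreover have "at t within {0..t + 1} = at t within {0..}"
    by (rule at_within_nhd[of _ "{..<t + 1}"]) auto
  ultimately show ?thesis
    by simp
qed

text \<open>The integral of \<open>k * exp (c * s)\<close> grows like
  \<open>k / c * exp (c * t)\<close>, and the weight cancels this growth. The bound, uniform in
  \<open>t\<close>, yields both the boundedness of the Picard operator and its contraction
  factor.\<close>

lemma norm_integral_exp_bound:
  fixes g :: "real \<Rightarrow> 'a::banach"
  assumes "continuous_on {0..} g" and "0 \<le> t" and "0 < c" and "0 \<le> k"
    and bound: "\<And>s. 0 \<le> s \<Longrightarrow> norm (g s) \<le> k * exp (c * s)"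
  shows "exp (- (c * t)) * norm (integral {0..t} g) \<le> k / c"
proof -
  have "((\<lambda>s. k * exp (c * s)) has_integral k / c * exp (c * t) - k / c * exp (c * 0)) {0..t}"
    using \<open>0 \<le> t\<close> \<open>0 < c\<close>
    by (intro fundamental_theorem_of_calculus)
       (auto intro!: derivative_eq_intros simp flip: has_real_derivative_iff_has_vector_derivative)
  moreover have "g integrable_on {0..t}"
    by (intro integrable_continuous_real continuous_on_subset[OF assms(1)]) auto
  ultimately have "norm (integral {0..t} g) \<le> k / c * exp (c * t) - k / c * exp (c * 0)"
    using integral_norm_bound_integral[of g "{0..t}" "\<lambda>s. k * exp (c * s)"] bound
    by (auto simp: has_integral_iff)
  also have "\<dots> \<le> k / c * exp (c * t)"
    using \<open>0 < c\<close> \<open>0 \<le> k\<close> by simp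
  finally show ?thesis
    by (simp add: exp_minus field_simps)
qed

text \<open>
  Picard iteration in the norm \<open>sup\<^sub>t e\<^sup>-\<^sup>c\<^sup>t |x t|\<close> with \<open>c > L\<close>, for which the integral operator is
  a contraction on all of \<open>[0, \<infinity>)\<close>; bounded continuous functions on the whole line are used as the
  complete space, reading negative times as \<open>0\<close>.
\<close>

lemma lipschitz_ode_global_solution:
  fixes F :: "'a::banach \<Rightarrow> 'a"
  assumes L: "L-lipschitz_on UNIV F"
  obtains x where "x 0 = x0"
    and "\<And>t. 0 \<le> t \<Longrightarrow> (x has_vector_derivative F (x t)) (at t within {0..})"
proof -
  \<comment> \<open>Any \<open>c > L\<close> makes the factor \<open>L / c\<close> less than 1;
    adding 1 also keeps \<open>c\<close> positive when \<open>L = 0\<close>.\<close>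
  define c where "c = L + 1"
  have "0 \<le> L"
    using L by (rule lipschitz_on_nonneg)
  then have "0 < c"
    by (simp add: c_def)
  have lip: "norm (F x - F y) \<le> L * norm (x - y)" for x y
    using lipschitz_onD[OF L, of x y] by (simp add: dist_norm)
  have "continuous_on UNIV F"
    using L by (rule lipschitz_on_continuous_on)
  \<comment> \<open>The unknown is \<open>\<xi> t = exp (- c * t) *\<^sub>R x t\<close>, so the
    weighted norm of \<open>x\<close> is the plain supremum norm of \<open>\<xi>\<close>;
    \<open>g \<xi>\<close> is \<open>F\<close> along the \<open>x\<close> recovered from
    \<open>\<xi>\<close>.\<close>
  define g where "g \<xi> s = F (exp (c * s) *\<^sub>R apply_bcontfun \<xi> s)" for \<xi> s
  have cont_g: "continuous_on S (g \<xi>)" for S \<xi>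
    unfolding g_def
    by (rule continuous_on_compose2[OF \<open>continuous_on UNIV F\<close>]) (auto intro!: continuous_intros)
  define T0 where
    "T0 \<xi> t = exp (- (c * max 0 t)) *\<^sub>R (x0 + integral {0..max 0 t} (g \<xi>))" for \<xi> t
  have "T0 \<xi> \<in> bcontfun" for \<xi>
  proof -
    have "continuous_on {0..} (\<lambda>t. integral {0..t} (g \<xi>))"
      using has_vector_derivative_integral_from_0[OF cont_g]
      by (intro continuous_on_vector_derivative) auto
    then have "continuous_on UNIV (\<lambda>t. integral {0..max 0 t} (g \<xi>))"
      by (rule continuous_on_compose2) (auto intro!: continuous_intros)
    then have "continuous_on UNIV (T0 \<xi>)"
      unfolding T0_def by (intro continuous_intros)
    moreover have "bounded (range (T0 \<xi>))"
    proof -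
      obtain B where B: "\<And>t. norm (apply_bcontfun \<xi> t) \<le> B"
        using bounded_apply_bcontfun[of \<xi>] by (auto simp: bounded_iff)
      then have "0 \<le> B"
        using norm_ge_zero order_trans by blast
      have gb: "norm (g \<xi> s) \<le> (norm (F 0) + L * B) * exp (c * s)" if "0 \<le> s" for s
      proof -
        have "norm (g \<xi> s) \<le> norm (F 0) + norm (F (exp (c * s) *\<^sub>R apply_bcontfun \<xi> s) - F 0)"
          unfolding g_def by (simp add: norm_triangle_sub)
        also have "\<dots> \<le> norm (F 0) + L * norm (exp (c * s) *\<^sub>R apply_bcontfun \<xi> s)"
          using lip[of "exp (c * s) *\<^sub>R apply_bcontfun \<xi> s" 0] by simp
        \<comment> \<open>For \<open>s \<ge> 0\<close> the exponential is at least 1 and can be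
          attached to the constant term.\<close>
        also have "\<dots> \<le> norm (F 0) * exp (c * s) + L * (exp (c * s) * B)"
          using that \<open>0 \<le> L\<close> \<open>0 < c\<close> B[of s]
          by (intro add_mono mult_left_mono) (auto intro: mult_left_mono simp: mult_le_cancel_left1)
        finally show ?thesis
          by (simp add: algebra_simps)
      qed
      have "norm (T0 \<xi> t) \<le> norm x0 + (norm (F 0) + L * B) / c" for t
      proof -
        have "norm (T0 \<xi> t) \<le> exp (- (c * max 0 t)) * norm x0
            + exp (- (c * max 0 t)) * norm (integral {0..max 0 t} (g \<xi>))"
          unfolding T0_def by (simp add: norm_triangle_ineq flip: distrib_left)
        also have "exp (- (c * max 0 t)) * norm x0 \<le> norm x0"
          using \<open>0 < c\<close> by (intro mult_left_le_one_le) auto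
        also have "exp (- (c * max 0 t)) * norm (integral {0..max 0 t} (g \<xi>))
            \<le> (norm (F 0) + L * B) / c"
          using \<open>0 \<le> L\<close> \<open>0 \<le> B\<close> \<open>0 < c\<close> gb by (intro norm_integral_exp_bound cont_g) auto
        finally show ?thesis
          by simp
      qed
      then show ?thesis
        by (auto simp: bounded_iff)
    qed
    ultimately show ?thesis
      by (simp add: bcontfun_def)
  qed
  then have T: "apply_bcontfun (Bcontfun (T0 \<xi>)) = T0 \<xi>" for \<xi>
    by (rule Bcontfun_inverse)
  have "dist (Bcontfun (T0 \<xi>)) (Bcontfun (T0 \<zeta>)) \<le> L / c * dist \<xi> \<zeta>" for \<xi> \<zeta>
  proof (rule dist_bound)
    fix t
    have "g \<xi> integrable_on {0..max 0 t}" "g \<zeta> integrable_on {0..max 0 t}"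
      by (intro integrable_continuous_real cont_g)+
    then have "T0 \<xi> t - T0 \<zeta> t
        = exp (- (c * max 0 t)) *\<^sub>R integral {0..max 0 t} (\<lambda>s. g \<xi> s - g \<zeta> s)"
      unfolding T0_def by (simp add: integral_diff flip: scaleR_diff_right)
    then have "dist (T0 \<xi> t) (T0 \<zeta> t)
        = exp (- (c * max 0 t)) * norm (integral {0..max 0 t} (\<lambda>s. g \<xi> s - g \<zeta> s))"
      by (simp add: dist_norm)
    also have "\<dots> \<le> L * dist \<xi> \<zeta> / c"
    proof (rule norm_integral_exp_bound)
      fix s :: real
      have "norm (g \<xi> s - g \<zeta> s)
          \<le> L * norm (exp (c * s) *\<^sub>R apply_bcontfun \<xi> s - exp (c * s) *\<^sub>R apply_bcontfun \<zeta> s)"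
        unfolding g_def by (rule lip)
      also have "\<dots> = L * (exp (c * s) * dist (apply_bcontfun \<xi> s) (apply_bcontfun \<zeta> s))"
        by (simp add: dist_norm flip: scaleR_diff_right)
      also have "\<dots> \<le> L * (exp (c * s) * dist \<xi> \<zeta>)"
        using \<open>0 \<le> L\<close> by (intro mult_left_mono dist_bounded) auto
      finally show "norm (g \<xi> s - g \<zeta> s) \<le> L * dist \<xi> \<zeta> * exp (c * s)"
        by (simp add: mult_ac)
    qed (use \<open>0 \<le> L\<close> \<open>0 < c\<close> in \<open>auto intro!: continuous_intros cont_g\<close>)
    finally show "dist (apply_bcontfun (Bcontfun (T0 \<xi>)) t) (apply_bcontfun (Bcontfun (T0 \<zeta>)) t)
        \<le> L / c * dist \<xi> \<zeta>"
      by (simp add: T)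
  qed
  moreover have "0 \<le> L / c" "L / c < 1"
    using \<open>0 \<le> L\<close> by (auto simp: c_def)
  ultimately obtain \<xi> where "Bcontfun (T0 \<xi>) = \<xi>"
    using banach_fix_type[of "L / c" "\<lambda>\<xi>. Bcontfun (T0 \<xi>)"] by blast
  then have \<xi>: "apply_bcontfun \<xi> = T0 \<xi>"
    using T by metis
  define x where "x t = exp (c * t) *\<^sub>R apply_bcontfun \<xi> t" for t
  have x: "x t = x0 + integral {0..t} (\<lambda>s. F (x s))" if "0 \<le> t" for t
  proof -
    have "x t = exp (c * t) *\<^sub>R T0 \<xi> t"
      by (simp add: x_def \<xi>)
    also have "\<dots> = x0 + integral {0..t} (g \<xi>)"
      using that by (simp add: T0_def flip: exp_add)
    finally show ?thesis
      by (simp add: g_def[abs_def] x_def)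
  qed
  show ?thesis
  proof (rule that[of x])
    show "x 0 = x0"
      using x[of 0] by simp
    fix t :: real assume "0 \<le> t"
    have "((\<lambda>u. x0 + integral {0..u} (\<lambda>s. F (x s))) has_vector_derivative F (x t))
        (at t within {0..})"
      using has_vector_derivative_integral_from_0[OF cont_g \<open>0 \<le> t\<close>, of \<xi>]
      by (auto intro!: derivative_eq_intros simp: g_def[abs_def] x_def)
    \<comment> \<open>\<open>x\<close> agrees with the integral formula only at nonnegative times,
      which suffices for the derivative within \<open>{0..}\<close>.\<close>
    then show "(x has_vector_derivative F (x t)) (at t within {0..})"
      by (rule has_vector_derivative_transform[rotated 2]) (use \<open>0 \<le> t\<close> x in auto)
  qed
qed

section \<open>Quadratic forms and the Lyapunov inequality\<close>

lemma diag_of_mult_vec_component [simp]: "(diag_of d *v z) $ i = d $ i * z $ i"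
proof -
  have "(diag_of d *v z) $ i = (\<Sum>j\<in>UNIV. if i = j then d $ i * z $ j else 0)"
    unfolding matrix_vector_mult_def diag_of_def vec_lambda_beta by (rule sum.cong) auto
  then show ?thesis
    by simp
qed

lemma is_diagonal_eq_diag_of: "is_diagonal A \<Longrightarrow> A = diag_of (\<chi> i. A $ i $ i)"
  by (auto simp: is_diagonal_def diag_of_def vec_eq_iff)

lemma pos_semidef_diag_nonneg:
  assumes "pos_semidef A"
  shows "0 \<le> A $ i $ i"
proof -
  have "0 \<le> axis i 1 \<bullet> (A *v axis i 1)"
    using assms by (simp add: pos_semidef_def)
  then show ?thesis
    by (simp add: inner_axis' matrix_vector_mult_basis column_def)
qed

lemma loewner_le_0_imp_nonpos:
  assumes "loewner_le A 0"
  shows "v \<bullet> (A *v v) \<le> 0"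
proof -
  have "0 \<le> v \<bullet> ((0 - A) *v v)"
    using assms unfolding loewner_le_def pos_semidef_def by blast
  then show ?thesis
    by (simp add: matrix_vector_mult_diff_rdistrib inner_diff_right del: diff_0)
qed

lemma inner_transpose_mult:
  fixes A :: "real ^ 'n ^ 'm"
  shows "x \<bullet> (transpose A *v y) = (A *v x) \<bullet> y"
  by (metis dot_lmul_matrix inner_commute transpose_matrix_vector)

lemma inner_herm: "v \<bullet> (herm Y *v v) = 2 * (v \<bullet> (Y *v v))"
  by (simp add: herm_def matrix_vector_mult_add_rdistrib inner_add_right inner_transpose_mult
      inner_commute del: transpose_matrix_vector)

text \<open>The constant is the minimum of the form on the compact unit sphere; homogeneity of
  degree 2 extends the bound to all vectors.\<close>

lemma pos_def_lower_bound:
  assumes "pos_def P"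
  obtains a where "0 < a" and "\<And>v. a * (norm v)\<^sup>2 \<le> v \<bullet> (P *v v)"
proof -
  have "\<exists>u\<in>sphere 0 1. \<forall>v\<in>sphere 0 1. u \<bullet> (P *v u) \<le> v \<bullet> (P *v v)"
    by (intro continuous_attains_inf continuous_intros linear_continuous_on
        matrix_vector_mul_bounded_linear) auto
  then obtain u where u: "norm u = 1" "\<And>v. norm v = 1 \<Longrightarrow> u \<bullet> (P *v u) \<le> v \<bullet> (P *v v)"
    by auto
  show ?thesis
  proof (rule that)
    show "0 < u \<bullet> (P *v u)"
      using assms u(1) unfolding pos_def_def by (metis norm_zero zero_neq_one)
    fix v
    show "u \<bullet> (P *v u) * (norm v)\<^sup>2 \<le> v \<bullet> (P *v v)"
    proof (cases "v = 0")
      case False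
      have "u \<bullet> (P *v u) \<le> (v /\<^sub>R norm v) \<bullet> (P *v (v /\<^sub>R norm v))"
        using False by (intro u(2)) simp
      also have "\<dots> = v \<bullet> (P *v v) / (norm v)\<^sup>2"
        by (simp add: matrix_vector_mult_scaleR power2_eq_square divide_simps)
      finally show ?thesis
        using False by (simp add: pos_le_divide_eq)
    qed simp
  qed
qed

lemma quadratic_form_upper_bound:
  fixes P :: "real ^ 'n ^ 'n"
  obtains b where "0 < b" and "\<And>v. v \<bullet> (P *v v) \<le> b * (norm v)\<^sup>2"
proof -
  obtain b where b: "0 < b" "\<And>v. norm (P *v v) \<le> norm v * b"
    using bounded_linear.pos_bounded[OF matrix_vector_mul_bounded_linear[of P]] by blast
  have "v \<bullet> (P *v v) \<le> b * (norm v)\<^sup>2" for v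
  proof -
    have "v \<bullet> (P *v v) \<le> norm v * norm (P *v v)"
      by (rule norm_cauchy_schwarz)
    also have "\<dots> \<le> norm v * (norm v * b)"
      by (intro mult_left_mono b) auto
    finally show ?thesis
      by (simp add: power2_eq_square mult_ac)
  qed
  with b(1) show ?thesis
    by (rule that)
qed

text \<open>The stacked column vector on which \<open>block_row\<close> matrices act and at which
  the matrix inequality is evaluated.\<close>

definition vec_join :: "'a ^ 'n \<Rightarrow> 'a ^ 'q \<Rightarrow> 'a ^ ('n + 'q)" where
  "vec_join x e = (\<chi> k. case k of Inl i \<Rightarrow> x $ i | Inr j \<Rightarrow> e $ j)"

lemma block_row_mult_vec_join:
  fixes A :: "real ^ 'n::finite ^ 'm" and B :: "real ^ 'q::finite ^ 'm"
  shows "block_row A B *v vec_join x e = A *v x + B *v e"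
  by (simp add: vec_eq_iff matrix_vector_mult_def block_row_def vec_join_def sum.Plus
      flip: UNIV_Plus_UNIV)

lemma mat_X_mult_vec_join [simp]: "mat_X *v vec_join x e = x"
  by (simp add: mat_X_def block_row_mult_vec_join)

lemma mat_H_mult_vec_join [simp]: "mat_H *v vec_join x e = e"
  by (simp add: mat_H_def block_row_mult_vec_join)

text \<open>Diagonality splits the three terms of \<open>mat_M\<close> into sums over components,
  and there \<open>- l u z^2 + (l + u) z e - e^2\<close> factors as
  \<open>(e - l z) (u z - e)\<close>.\<close>

lemma inner_mat_M_vec_join:
  fixes U :: "real ^ 'p ^ 'q" and Cp :: "real ^ 'n ^ 'p" and W :: "real ^ 'q ^ 'q"
    and x :: "real ^ 'n" and e :: "real ^ 'q"
  defines "z \<equiv> W *v e + U *v (Cp *v x)"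
  shows "vec_join x e \<bullet> (mat_M (diag_of l) (diag_of u) (diag_of c) (mat_Z U Cp W) *v vec_join x e)
    = 2 * (\<Sum>i\<in>UNIV. c $ i * ((e $ i - l $ i * z $ i) * (u $ i * z $ i - e $ i)))"
proof -
  have Z: "mat_Z U Cp W *v vec_join x e = z"
    by (simp add: mat_Z_def block_row_mult_vec_join z_def add.commute flip: matrix_vector_mul_assoc)
  have "vec_join x e \<bullet> (mat_M (diag_of l) (diag_of u) (diag_of c) (mat_Z U Cp W) *v vec_join x e)
    = - 2 * (z \<bullet> (diag_of l *v (diag_of c *v (diag_of u *v z))))
      + 2 * (e \<bullet> (diag_of c *v (diag_of l *v z + diag_of u *v z)))
      - 2 * (e \<bullet> (diag_of c *v e))"
    unfolding mat_M_def
    by (simp add: matrix_vector_mult_add_rdistrib matrix_vector_mult_diff_rdistrib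
        inner_add_right inner_diff_right inner_herm Z inner_transpose_mult
        del: transpose_matrix_vector
        flip: matrix_vector_mul_assoc scaleR_matrix_vector_assoc)
  also have "\<dots> = 2 * (\<Sum>i\<in>UNIV. c $ i * ((e $ i - l $ i * z $ i) * (u $ i * z $ i - e $ i)))"
    by (simp add: inner_vec_def sum_distrib_left algebra_simps flip: sum.distrib sum_subtractf
        sum_negf)
  finally show ?thesis .
qed

lemma lyapunov_dissipation:
  fixes Ap :: "real ^ 'n ^ 'n" and Bp :: "real ^ 'm ^ 'n" and Cp :: "real ^ 'n ^ 'p"
    and K :: "real ^ 'p ^ 'm" and V :: "real ^ 'q ^ 'm" and U :: "real ^ 'p ^ 'q"
  assumes sector: "static_sector \<phi> \<phi>c D0 D1"
    and "is_diagonal \<Lambda>" "pos_semidef \<Lambda>"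
    and lmi: "loewner_le
      (herm (transpose mat_X ** P ** mat_Fc Ap Bp Cp K V)
       + \<alpha> *\<^sub>R (transpose mat_X ** P ** mat_X) + mat_M D0 D1 \<Lambda> (mat_Z U Cp W)) 0"
    and e: "e = \<phi> (W *v e + U *v (Cp *v x))"
  shows "2 * (x \<bullet> (P *v (Ap *v x + Bp *v (K *v (Cp *v x) + V *v e)))) \<le> - \<alpha> * (x \<bullet> (P *v x))"
proof -
  define z where "z = W *v e + U *v (Cp *v x)"
  define c where "c = (\<chi> i. \<Lambda> $ i $ i)"
  have \<Lambda>: "\<Lambda> = diag_of c"
    unfolding c_def by (rule is_diagonal_eq_diag_of) fact
  have c: "0 \<le> c $ i" for i
    unfolding c_def by (simp add: pos_semidef_diag_nonneg assms)
  obtain l u where D: "D0 = diag_of l" "D1 = diag_of u"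
    and lu: "\<And>i z. (\<phi>c i z - l $ i * z) * (u $ i * z - \<phi>c i z) \<ge> 0"
    and "acts_componentwise \<phi> \<phi>c"
    using sector unfolding static_sector_def by auto
  \<comment> \<open>The implicit equation read componentwise, so that the scalar sector inequality
    applies at \<open>z $ i\<close>.\<close>
  then have ei: "e $ i = \<phi>c i (z $ i)" for i
    using e unfolding acts_componentwise_def z_def by metis
  let ?v = "vec_join x e"
  have "0 \<le> ?v \<bullet> (mat_M D0 D1 \<Lambda> (mat_Z U Cp W) *v ?v)"
    unfolding \<Lambda> D inner_mat_M_vec_join
    by (simp add: sum_nonneg c lu ei flip: z_def)
  moreover have "?v \<bullet> ((herm (transpose mat_X ** P ** mat_Fc Ap Bp Cp K V)
       + \<alpha> *\<^sub>R (transpose mat_X ** P ** mat_X) + mat_M D0 D1 \<Lambda> (mat_Z U Cp W)) *v ?v) \<le> 0"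
    using lmi by (rule loewner_le_0_imp_nonpos)
  moreover have "mat_Fc Ap Bp Cp K V *v ?v = Ap *v x + Bp *v (K *v (Cp *v x) + V *v e)"
    by (simp add: mat_Fc_def block_row_mult_vec_join matrix_vector_mult_add_rdistrib
        matrix_vector_right_distrib flip: matrix_vector_mul_assoc)
  ultimately show ?thesis
    by (simp add: matrix_vector_mult_add_rdistrib inner_add_right inner_herm inner_transpose_mult
        del: transpose_matrix_vector
        flip: matrix_vector_mul_assoc scaleR_matrix_vector_assoc)
qed

text \<open>The product \<open>exp (\<alpha> * t) * f t\<close> has a nonpositive derivative, and
  the mean value theorem compares its values at \<open>t\<close> and 0.\<close>

lemma exponential_decay_of_differential_inequality:
  fixes f :: "real \<Rightarrow> real"
  assumes deriv: "\<And>t. 0 \<le> t \<Longrightarrow> (f has_real_derivative f' t) (at t within {0..})"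
    and le: "\<And>t. 0 \<le> t \<Longrightarrow> f' t \<le> - \<alpha> * f t"
    and "0 \<le> t"
  shows "f t \<le> exp (- \<alpha> * t) * f 0"
proof -
  have "((\<lambda>s. exp (\<alpha> * s) * f s) has_real_derivative exp (\<alpha> * s) * (\<alpha> * f s + f' s))
      (at s within {0..t})" if "s \<in> {0..t}" for s
    using that by (auto intro!: derivative_eq_intros DERIV_subset[OF deriv] simp: algebra_simps)
  then obtain s where "s \<in> {0..t}"
    and s: "exp (\<alpha> * t) * f t - exp (\<alpha> * 0) * f 0 = exp (\<alpha> * s) * (\<alpha> * f s + f' s) * (t - 0)"
    using mvt_very_simple[OF \<open>0 \<le> t\<close>, of "\<lambda>s. exp (\<alpha> * s) * f s"
        "\<lambda>s. (*) (exp (\<alpha> * s) * (\<alpha> * f s + f' s))"]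
    unfolding has_field_derivative_def by auto
  have "\<alpha> * f s + f' s \<le> 0"
    using le[of s] \<open>s \<in> {0..t}\<close> by simp
  then have "exp (\<alpha> * s) * (\<alpha> * f s + f' s) * (t - 0) \<le> 0"
    using \<open>0 \<le> t\<close> by (intro mult_nonpos_nonneg mult_nonneg_nonpos) auto
  then have "exp (\<alpha> * t) * f t \<le> f 0"
    using s by simp
  then show ?thesis
    by (simp add: exp_minus field_simps)
qed

text \<open>Passing from the squared norm to the norm takes square roots, which halves the rate and
  gives the constant \<open>sqrt (b / a)\<close>.\<close>

lemma norm_decay_of_quadratic_decay:
  fixes x :: "real \<Rightarrow> real ^ 'n"
  assumes "0 < a" "\<And>v. a * (norm v)\<^sup>2 \<le> v \<bullet> (P *v v)" "\<And>v. v \<bullet> (P *v v) \<le> b * (norm v)\<^sup>2"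
    and decay: "x t \<bullet> (P *v x t) \<le> exp (- \<alpha> * t) * (x 0 \<bullet> (P *v x 0))"
  shows "norm (x t) \<le> sqrt (b / a) * exp (- (\<alpha> / 2) * t) * norm (x 0)"
proof -
  have "a * (norm (x t))\<^sup>2 \<le> exp (- \<alpha> * t) * (b * (norm (x 0))\<^sup>2)"
    using assms(2)[of "x t"] decay mult_left_mono[OF assms(3)[of "x 0"], of "exp (- \<alpha> * t)"]
    by (meson exp_ge_zero order_trans)
  then have "(norm (x t))\<^sup>2 \<le> b / a * exp (- \<alpha> * t) * (norm (x 0))\<^sup>2"
    using \<open>0 < a\<close> by (simp add: field_simps)
  then have "sqrt ((norm (x t))\<^sup>2) \<le> sqrt (b / a * exp (- \<alpha> * t) * (norm (x 0))\<^sup>2)"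
    by (rule real_sqrt_le_mono)
  also have "\<dots> = sqrt (b / a) * sqrt (exp (- \<alpha> * t)) * norm (x 0)"
    by (simp only: real_sqrt_mult real_sqrt_abs abs_norm_cancel)
  also have "sqrt (exp (- \<alpha> * t)) = exp (- (\<alpha> / 2) * t)"
    by (rule real_sqrt_unique) (auto simp: power2_eq_square simp flip: exp_add)
  finally show ?thesis
    by simp
qed

section \<open>The closed loop\<close>

text \<open>Replacing \<eta> by the Lipschitz solution map \<open>G\<close> leaves an autonomous
  differential equation for \<open>x\<close> alone, whose right side is a sum of compositions of
  Lipschitz maps.\<close>

lemma closed_loop_trajectory_exists:
  fixes Ap :: "real ^ 'n ^ 'n" and Bp :: "real ^ 'm ^ 'n" and Cp :: "real ^ 'n ^ 'p"
    and K :: "real ^ 'p ^ 'm" and V :: "real ^ 'q ^ 'm"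
    and W :: "real ^ 'q ^ 'q" and U :: "real ^ 'p ^ 'q"
  assumes pf: "lambda_pf \<bar>W\<bar> < 1" and nonexp: "\<And>r s. \<bar>\<phi> r - \<phi> s\<bar> \<le> \<bar>r - s\<bar>"
  shows "\<exists>x\<in>closed_loop_states Ap Bp Cp K V W U \<phi>. x 0 = x0"
proof -
  obtain G L where G: "\<And>b. G b = \<phi> (W *v G b + b)" and L: "L-lipschitz_on UNIV G"
    using implicit_equation_solution[OF pf nonexp] by blast
  define F where "F x = Ap *v x + Bp *v (K *v (Cp *v x) + V *v G (U *v (Cp *v x)))" for x
  obtain LA LB LC LK LV LU where
    "LA-lipschitz_on UNIV ((*v) Ap)" "LB-lipschitz_on UNIV ((*v) Bp)"
    "LC-lipschitz_on UNIV ((*v) Cp)" "LK-lipschitz_on UNIV ((*v) K)"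
    "LV-lipschitz_on UNIV ((*v) V)" "LU-lipschitz_on UNIV ((*v) U)"
    using bounded_linear.lipschitz_boundE[OF matrix_vector_mul_bounded_linear] by metis
  note lip = this L
  have "(LA + LB * (LK * LC + LV * (L * (LU * LC))))-lipschitz_on UNIV F"
    unfolding F_def
    by (intro lipschitz_on_add lipschitz_on_compose2 lip lip[THEN lipschitz_on_subset] subset_UNIV)
  then obtain x where x: "x 0 = x0"
    and deriv: "\<And>t. 0 \<le> t \<Longrightarrow> (x has_vector_derivative F (x t)) (at t within {0..})"
    using lipschitz_ode_global_solution by metis
  have "closed_loop_trajectory Ap Bp Cp K V W U \<phi> x
      (\<lambda>t. K *v (Cp *v x t) + V *v G (U *v (Cp *v x t))) (\<lambda>t. Cp *v x t)
      (\<lambda>t. G (U *v (Cp *v x t)))"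
    unfolding closed_loop_trajectory_def using deriv G by (simp add: F_def)
  with x show ?thesis
    unfolding closed_loop_states_def by blast
qed

lemma closed_loop_lyapunov_decay:
  fixes Ap :: "real ^ 'n ^ 'n" and Bp :: "real ^ 'm ^ 'n" and Cp :: "real ^ 'n ^ 'p"
    and K :: "real ^ 'p ^ 'm" and V :: "real ^ 'q ^ 'm" and U :: "real ^ 'p ^ 'q"
  assumes sector: "static_sector \<phi> \<phi>c D0 D1"
    and \<Lambda>: "is_diagonal \<Lambda>" "pos_semidef \<Lambda>" and P: "transpose P = P"
    and lmi: "loewner_le
      (herm (transpose mat_X ** P ** mat_Fc Ap Bp Cp K V)
       + \<alpha> *\<^sub>R (transpose mat_X ** P ** mat_X) + mat_M D0 D1 \<Lambda> (mat_Z U Cp W)) 0"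
    and traj: "closed_loop_trajectory Ap Bp Cp K V W U \<phi> x u y \<eta>" and "0 \<le> t"
  shows "x t \<bullet> (P *v x t) \<le> exp (- \<alpha> * t) * (x 0 \<bullet> (P *v x 0))"
proof (rule exponential_decay_of_differential_inequality[OF _ _ \<open>0 \<le> t\<close>])
  fix t :: real assume "0 \<le> t"
  let ?d = "Ap *v x t + Bp *v (K *v (Cp *v x t) + V *v \<eta> t)"
  have deriv: "(x has_vector_derivative ?d) (at t within {0..})"
    and \<eta>: "\<eta> t = \<phi> (W *v \<eta> t + U *v (Cp *v x t))"
    using traj \<open>0 \<le> t\<close> unfolding closed_loop_trajectory_def by metis+
  \<comment> \<open>Symmetry of \<open>P\<close> merges the two terms of the product rule into the
    factor 2.\<close>
  have sym: "v \<bullet> (P *v w) = w \<bullet> (P *v v)" for v w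
    by (metis P inner_commute inner_transpose_mult)
  have "((\<lambda>t. x t \<bullet> (P *v x t)) has_vector_derivative x t \<bullet> (P *v ?d) + ?d \<bullet> (P *v x t))
      (at t within {0..})"
    by (intro bounded_bilinear.has_vector_derivative[OF bounded_bilinear_inner] deriv
        bounded_linear.has_vector_derivative[OF matrix_vector_mul_bounded_linear])
  then show "((\<lambda>t. x t \<bullet> (P *v x t)) has_real_derivative
      2 * (x t \<bullet> (P *v (Ap *v x t + Bp *v (K *v (Cp *v x t) + V *v \<eta> t))))) (at t within {0..})"
    using sym[of ?d "x t"] by (simp add: has_real_derivative_iff_has_vector_derivative)
  show "2 * (x t \<bullet> (P *v ?d)) \<le> - \<alpha> * (x t \<bullet> (P *v x t))"
    by (rule lyapunov_dissipation[OF sector \<Lambda> lmi \<eta>])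
qed

theorem theorem3:
  fixes Ap :: "real ^ 'n ^ 'n" and Bp :: "real ^ 'm ^ 'n" and Cp :: "real ^ 'n ^ 'p"
    and K :: "real ^ 'p ^ 'm" and V :: "real ^ 'q ^ 'm"
    and W :: "real ^ 'q ^ 'q" and U :: "real ^ 'p ^ 'q"
    and \<phi> :: "real ^ 'q \<Rightarrow> real ^ 'q" and \<phi>c :: "'q \<Rightarrow> real \<Rightarrow> real"
    and D0 D1 \<Lambda> :: "real ^ 'q ^ 'q"
    and P :: "real ^ 'n ^ 'n" and \<alpha> :: real
  assumes "componentwise_nonexpansive \<phi> \<phi>c"
    and "static_sector \<phi> \<phi>c D0 D1"
    and "lambda_pf \<bar>W\<bar> < 1"
    and "pos_def P"
    and "is_diagonal \<Lambda>" and "pos_semidef \<Lambda>"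
    and "\<alpha> > 0"
    and "loewner_le
           (herm (transpose mat_X ** P ** mat_Fc Ap Bp Cp K V)
            + \<alpha> *\<^sub>R (transpose mat_X ** P ** mat_X)
            + mat_M D0 D1 \<Lambda> (mat_Z U Cp W)) 0"
  shows "origin_globally_exponentially_stable (closed_loop_states Ap Bp Cp K V W U \<phi>) \<and>
         (\<forall>x u y \<eta>. closed_loop_trajectory Ap Bp Cp K V W U \<phi> x u y \<eta> \<longrightarrow>
            (\<forall>t\<ge>0. x t \<bullet> (P *v x t) \<le> exp (- \<alpha> * t) * (x 0 \<bullet> (P *v x 0))))"
proof -
  have P: "transpose P = P"
    using assms(4) by (simp add: pos_def_def)
  note decay = closed_loop_lyapunov_decay[OF assms(2,5,6) P assms(8)]
  obtain a where a: "0 < a" "\<And>v. a * (norm v)\<^sup>2 \<le> v \<bullet> (P *v v)"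
    using pos_def_lower_bound[OF assms(4)] by blast
  obtain b where b: "0 < b" "\<And>v. v \<bullet> (P *v v) \<le> b * (norm v)\<^sup>2"
    using quadratic_form_upper_bound by blast
  \<comment> \<open>The constants \<open>sqrt (b / a)\<close> and \<open>\<alpha> / 2\<close> depend
    only on \<open>P\<close> and \<alpha>, hence serve all trajectories at once.\<close>
  have "norm (x t) \<le> sqrt (b / a) * exp (- (\<alpha> / 2) * t) * norm (x 0)"
    if "x \<in> closed_loop_states Ap Bp Cp K V W U \<phi>" "0 \<le> t" for x t
    using that decay norm_decay_of_quadratic_decay[OF a b(2)]
    unfolding closed_loop_states_def by blast
  moreover have "0 < sqrt (b / a)" "0 < \<alpha> / 2"
    using a b \<open>\<alpha> > 0\<close> by auto
  moreover have "\<exists>x\<in>closed_loop_states Ap Bp Cp K V W U \<phi>. x 0 = x0" for x0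
    using assms(1,3)
    by (intro closed_loop_trajectory_exists) (auto simp: componentwise_nonexpansive_def)
  ultimately have "origin_globally_exponentially_stable (closed_loop_states Ap Bp Cp K V W U \<phi>)"
    unfolding origin_globally_exponentially_stable_def by blast
  with decay show ?thesis
    by blast
qed

end
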